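(* There exists an algorithm which, given {\sf NACOND} access to an unknown distribution $p$ on $[n]$ and a parameter $\varepsilon\in(0,1]$, makes $\tilde O\left(\frac{\log n}{\varepsilon^2}\right)$ queries to the oracle on $p$ and distinguishes between the cases $p = \mathcal{U}_n$ and $d_{\mathrm{TV}}(p,\mathcal{U}_n) \geq \varepsilon$ with probability at least $2/3$, where $\mathcal{U}_n$ is the uniform distribution on $[n]$.
   Context: Distributions are over the finite domain $[n]=\{1,\dots,n\}$; for $S\subseteq[n]$, $p(S)=\sum_{i\in S}p(i)$. A conditional sampling oracle for $p$ takes as input a query set $S\subseteq[n]$ and returns a symbol $i\in S$ drawn with probability $p(i)/p(S)$; if $p(S)=0$ it returns a uniformly random element of $S$. In the non-adaptive model ({\sf NACOND}), the algorithm must specify all of its query sets (possibly using its own randomness) before seeing the result of any query. Total variation distance: $d_{\mathrm{TV}}(p,q)=\frac12\sum_{i\in[n]}|p(i)-q(i)|$. $\log$ is base 2; $\tilde O(\cdot)$ hides factors polylogarithmic in its argument (e.g. factors polynomial in $\log\log n$). *)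

theory Defs
  imports "HOL-Probability.Probability"
begin

definition dist_on :: "nat \<Rightarrow> nat pmf \<Rightarrow> bool" where
  "dist_on n p \<longleftrightarrow> set_pmf p \<subseteq> {1..n}"

definition unif :: "nat \<Rightarrow> nat pmf" where
  "unif n = pmf_of_set {1..n}"

definition dtv :: "nat \<Rightarrow> nat pmf \<Rightarrow> nat pmf \<Rightarrow> real" where
  "dtv n p q = (1/2) * (\<Sum>i\<in>{1..n}. \<bar>pmf p i - pmf q i\<bar>)"

definition cond_sample :: "nat pmf \<Rightarrow> nat set \<Rightarrow> nat pmf" where
  "cond_sample p S =
     (if measure_pmf.prob p S = 0 then pmf_of_set S else cond_pmf p S)"

fun answers :: "nat pmf \<Rightarrow> nat set list \<Rightarrow> nat list pmf" where
  "answers p [] = return_pmf []"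
| "answers p (S # Ss) =
     bind_pmf (cond_sample p S) (\<lambda>x. bind_pmf (answers p Ss) (\<lambda>xs. return_pmf (x # xs)))"

text \<open>A non-adaptive conditional-sampling (NACOND) algorithm: given n and \<epsilon>, it uses its own
  randomness to pick, before seeing any answer, a list of query sets together with a
  decision rule mapping the list of answers to an output (True = "uniform").\<close>

type_synonym nacond_alg = "nat \<Rightarrow> real \<Rightarrow> (nat set list \<times> (nat list \<Rightarrow> bool)) pmf"

definition nacond_run :: "nacond_alg \<Rightarrow> nat \<Rightarrow> real \<Rightarrow> nat pmf \<Rightarrow> bool pmf" where
  "nacond_run A n \<epsilon> p =
     bind_pmf (A n \<epsilon>) (\<lambda>(Qs, D). map_pmf D (answers p Qs))"

text \<open>Query bound tilde-O(log n / \<epsilon>^2): C * (1 + x) * (1 + ln(1 + x))^k with x = log n / \<epsilon>^2.\<close>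

definition query_bound :: "real \<Rightarrow> nat \<Rightarrow> nat \<Rightarrow> real \<Rightarrow> real" where
  "query_bound C k n \<epsilon> =
     (let x = log 2 (real n) / \<epsilon>^2 in C * (1 + x) * (1 + ln (1 + x)) ^ k)"

end

theory Submission
  imports Defs
begin

text \<open>Bisect \<open>{1..n}\<close> recursively into a tree of intervals of depth L about log n, and let M be the mass
  of the node containing a uniformly random point, relative to its mass under the uniform
  distribution. Along the depth, M is a martingale from 1 to \<open>n * p i\<close>, and the mean of \<open>1 / (1 + M)\<close>
  grows by at least order \<open>\<epsilon>\<^sup>2\<close> in total when p is \<open>\<epsilon>\<close>-far from uniform. On the other hand splitting a
  node increases this mean by at most a constant times the squared difference between the
  conditional probability of the left half and its relative size. So a random node at a random
  depth has mean square bias of order \<open>\<epsilon>\<^sup>2 / L\<close>, whereas under the uniform distribution every bias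
  is 0. A bias whose square is \<open>\<rho>\<close> is seen with about \<open>1 / \<rho>\<close> samples from the node. By a
  dyadic pigeonhole some scale \<open>\<rho>\<close> is attained by a \<open>\<epsilon>\<^sup>2 / (L * \<rho>)\<close> fraction of the nodes, up to logarithms,
  and all scales can be tested at the same cost \<open>L / \<epsilon>\<^sup>2\<close>. The queries are intervals and do not depend
  on any answer.\<close>

subsection \<open>Independent conjunctions of strategies\<close>

type_synonym strategy = "(nat set list \<times> (nat list \<Rightarrow> bool)) pmf"

definition run :: "strategy \<Rightarrow> nat pmf \<Rightarrow> bool pmf" where
  "run T p = bind_pmf T (\<lambda>(Qs, D). map_pmf D (answers p Qs))"

definition conj_strategy :: "strategy \<Rightarrow> strategy \<Rightarrow> strategy" where
  "conj_strategy T U =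
     bind_pmf T (\<lambda>(Qs, D). bind_pmf U (\<lambda>(Rs, E).
       return_pmf (Qs @ Rs, \<lambda>xs. D (take (length Qs) xs) \<and> E (drop (length Qs) xs))))"

definition conj_strategies :: "strategy list \<Rightarrow> strategy" where
  "conj_strategies Ts = foldr conj_strategy Ts (return_pmf ([], \<lambda>_. True))"

lemma answers_append:
  "answers p (Qs @ Rs) =
     bind_pmf (answers p Qs) (\<lambda>xs. bind_pmf (answers p Rs) (\<lambda>ys. return_pmf (xs @ ys)))"
  by (induction Qs) (simp_all add: bind_assoc_pmf bind_return_pmf bind_return_pmf')

lemma length_answers: "xs \<in> set_pmf (answers p Qs) \<Longrightarrow> length xs = length Qs"
  by (induction Qs arbitrary: xs) auto

text \<open>The answers to \<open>Qs @ Rs\<close> split into two independent blocks, and each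
  decision reads only its own block. So the two strategies behave like separate runs, and acceptance
  probabilities multiply.\<close>

lemma run_conj_strategy:
  "run (conj_strategy T U) p =
     bind_pmf (run T p) (\<lambda>x. bind_pmf (run U p) (\<lambda>y. return_pmf (x \<and> y)))"
proof -
  have split: "map_pmf (\<lambda>xs. D (take (length Qs) xs) \<and> E (drop (length Qs) xs)) (answers p (Qs @ Rs)) =
      bind_pmf (map_pmf D (answers p Qs))
        (\<lambda>x. bind_pmf (map_pmf E (answers p Rs)) (\<lambda>y. return_pmf (x \<and> y)))"
    for Qs Rs :: "nat set list" and D E :: "nat list \<Rightarrow> bool"
    unfolding answers_append map_pmf_def bind_assoc_pmf bind_return_pmf
    by (intro bind_pmf_cong refl) (simp add: length_answers)
  have "run (conj_strategy T U) p =
      bind_pmf T (\<lambda>(Qs, D). bind_pmf U (\<lambda>(Rs, E).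
        bind_pmf (map_pmf D (answers p Qs))
          (\<lambda>x. bind_pmf (map_pmf E (answers p Rs)) (\<lambda>y. return_pmf (x \<and> y)))))"
    by (simp add: run_def conj_strategy_def bind_assoc_pmf case_prod_unfold bind_return_pmf split)
  also have "\<dots> = bind_pmf T (\<lambda>(Qs, D). bind_pmf (map_pmf D (answers p Qs))
      (\<lambda>x. bind_pmf (run U p) (\<lambda>y. return_pmf (x \<and> y))))"
    unfolding run_def case_prod_unfold bind_assoc_pmf
    \<comment> \<open>Non-adaptivity draws the queries of \<open>U\<close> before those of
      \<open>T\<close> are answered; swapping these independent draws completes the run of
      \<open>T\<close> first.\<close>
    by (intro bind_pmf_cong refl) (rule bind_commute_pmf)
  also have "\<dots> = bind_pmf (run T p) (\<lambda>x. bind_pmf (run U p) (\<lambda>y. return_pmf (x \<and> y)))"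
    unfolding run_def by (simp add: bind_assoc_pmf case_prod_unfold)
  finally show ?thesis .
qed

lemma pmf_run_conj_strategy:
  "pmf (run (conj_strategy T U) p) True = pmf (run T p) True * pmf (run U p) True"
proof -
  have "run (conj_strategy T U) p = map_pmf (\<lambda>(x, y). x \<and> y) (pair_pmf (run T p) (run U p))"
    by (simp add: run_conj_strategy pair_pmf_def map_pmf_def bind_assoc_pmf bind_return_pmf)
  moreover have "(\<lambda>(x, y). x \<and> y) -` {True} = {(True, True)}"
    by auto
  ultimately show ?thesis
    by (simp add: pmf_map measure_pmf_single pmf_pair)
qed

lemma pmf_run_conj_strategies:
  "pmf (run (conj_strategies Ts) p) True = prod_list (map (\<lambda>T. pmf (run T p) True) Ts)"
proof (induction Ts)
  case Nil
  show ?case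
    by (simp add: conj_strategies_def run_def bind_return_pmf)
next
  case (Cons T Ts)
  then show ?case
    by (simp add: conj_strategies_def pmf_run_conj_strategy)
qed

lemma conj_strategies_queries:
  assumes "(Qs, D) \<in> set_pmf (conj_strategies (map f xs))"
    and "\<And>x Rs E. x \<in> set xs \<Longrightarrow> (Rs, E) \<in> set_pmf (f x) \<Longrightarrow> set Rs \<subseteq> X \<and> length Rs = len x"
  shows "set Qs \<subseteq> X \<and> length Qs = sum_list (map len xs)"
  using assms
proof (induction xs arbitrary: Qs D)
  case Nil
  then show ?case
    by (simp add: conj_strategies_def)
next
  case (Cons x xs)
  from Cons.prems(1) obtain Rs E Rs' E'
    where *: "(Rs, E) \<in> set_pmf (f x)" "(Rs', E') \<in> set_pmf (conj_strategies (map f xs))"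
      "Qs = Rs @ Rs'"
    by (auto simp: conj_strategies_def conj_strategy_def)
  have "set Rs' \<subseteq> X \<and> length Rs' = sum_list (map len xs)"
    by (rule Cons.IH[OF *(2)]) (meson Cons.prems(2) list.set_intros(2))
  moreover have "set Rs \<subseteq> X \<and> length Rs = len x"
    using Cons.prems(2)[OF _ *(1)] by simp
  ultimately show ?case
    using *(3) by simp
qed

section \<open>Estimating one conditional probability by repeating a query\<close>

text \<open>Membership of one answer in \<open>A\<close> is a Bernoulli variable, and repeated
  queries are independent.\<close>

lemma count_answers_replicate:
  "map_pmf (\<lambda>xs. length (filter (\<lambda>x. x \<in> A) xs)) (answers p (replicate R S)) =
     binomial_pmf R (measure_pmf.prob (cond_sample p S) A)"
proof (induction R)
  case 0
  show ?case
    by (simp add: binomial_pmf_0)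
next
  case (Suc R)
  let ?c = "\<lambda>xs. length (filter (\<lambda>x. x \<in> A) xs)"
  let ?b = "measure_pmf.prob (cond_sample p S) A"
  have bern: "map_pmf (\<lambda>x. x \<in> A) (cond_sample p S) = bernoulli_pmf ?b"
  proof (rule pmf_eqI)
    fix b
    have "pmf (map_pmf (\<lambda>x. x \<in> A) (cond_sample p S)) True = ?b"
      by (simp add: pmf_map vimage_def)
    moreover have "(\<lambda>x. x \<in> A) -` {False} = UNIV - A"
      by auto
    then have "pmf (map_pmf (\<lambda>x. x \<in> A) (cond_sample p S)) False = 1 - ?b"
      using measure_pmf.prob_compl[of A "cond_sample p S"] by (simp add: pmf_map)
    ultimately show "pmf (map_pmf (\<lambda>x. x \<in> A) (cond_sample p S)) b = pmf (bernoulli_pmf ?b) b"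
      by (cases b) simp_all
  qed
  have "map_pmf ?c (answers p (replicate (Suc R) S)) =
      bind_pmf (map_pmf (\<lambda>x. x \<in> A) (cond_sample p S)) (\<lambda>b.
        bind_pmf (map_pmf ?c (answers p (replicate R S))) (\<lambda>k.
          return_pmf ((if b then 1 else 0) + k)))"
    unfolding map_pmf_def replicate_Suc answers.simps bind_assoc_pmf bind_return_pmf
    by (intro bind_pmf_cong refl) (simp add: if_distrib)
  then show ?case
    by (simp add: bern Suc.IH binomial_pmf_Suc)
qed

definition freq_test :: "nat \<Rightarrow> real \<Rightarrow> nat set \<times> nat set \<Rightarrow> nat set list \<times> (nat list \<Rightarrow> bool)" where
  "freq_test R \<tau> = (\<lambda>(S, A). (replicate R S,
     \<lambda>xs. \<bar>real (length (filter (\<lambda>x. x \<in> A) xs)) / real R - real (card A) / real (card S)\<bar> < \<tau>))"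

text \<open>Hoeffding's inequality bounds the chance that the empirical frequency is off by
  \<open>\<tau>\<close>. If \<open>\<beta> = \<alpha>\<close>, rejecting is such a deviation; if
  they differ by at least \<open>2 * \<tau>\<close>, accepting forces one by the triangle
  inequality.\<close>

lemma freq_test_cases:
  fixes p :: "nat pmf" and S A :: "nat set" and R :: nat and \<tau> :: real
  defines "\<beta> \<equiv> measure_pmf.prob (cond_sample p S) A"
  defines "\<alpha> \<equiv> real (card A) / real (card S)"
  defines "acc \<equiv> pmf (case freq_test R \<tau> (S, A) of (Qs, D) \<Rightarrow> map_pmf D (answers p Qs)) True"
  assumes "R > 0" "\<tau> \<ge> 0"
  shows "\<beta> = \<alpha> \<Longrightarrow> acc \<ge> 1 - 2 * exp (- 2 * real R * \<tau>\<^sup>2)"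
    and "\<bar>\<beta> - \<alpha>\<bar> \<ge> 2 * \<tau> \<Longrightarrow> acc \<le> 2 * exp (- 2 * real R * \<tau>\<^sup>2)"
proof -
  interpret binomial_distribution R \<beta>
    by unfold_locales (simp add: \<beta>_def)
  let ?B = "binomial_pmf R \<beta>"
  have "(case freq_test R \<tau> (S, A) of (Qs, D) \<Rightarrow> map_pmf D (answers p Qs)) =
      map_pmf (\<lambda>k. \<bar>real k / real R - \<alpha>\<bar> < \<tau>) ?B"
    unfolding \<beta>_def \<alpha>_def count_answers_replicate[symmetric]
    by (simp add: freq_test_def pmf.map_comp o_def)
  then have acc: "acc = measure_pmf.prob ?B {k. \<bar>real k / real R - \<alpha>\<bar> < \<tau>}"
    unfolding acc_def by (simp add: pmf_map vimage_def)
  have tail: "measure_pmf.prob ?B {k. \<bar>real k / real R - \<beta>\<bar> \<ge> \<tau>} \<le> 2 * exp (- 2 * real R * \<tau>\<^sup>2)"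
    using prob_abs_ge'[OF assms(4,5)] by simp
  show "acc \<ge> 1 - 2 * exp (- 2 * real R * \<tau>\<^sup>2)" if "\<beta> = \<alpha>"
  proof -
    have "UNIV - {k. \<bar>real k / real R - \<beta>\<bar> \<ge> \<tau>} = {k. \<bar>real k / real R - \<alpha>\<bar> < \<tau>}"
      using that by auto
    then have "acc = 1 - measure_pmf.prob ?B {k. \<bar>real k / real R - \<beta>\<bar> \<ge> \<tau>}"
      using measure_pmf.prob_compl[of "{k. \<bar>real k / real R - \<beta>\<bar> \<ge> \<tau>}" ?B] acc by simp
    then show ?thesis
      using tail by simp
  qed
  show "acc \<le> 2 * exp (- 2 * real R * \<tau>\<^sup>2)" if "\<bar>\<beta> - \<alpha>\<bar> \<ge> 2 * \<tau>"
  proof -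
    have "acc \<le> measure_pmf.prob ?B {k. \<bar>real k / real R - \<beta>\<bar> \<ge> \<tau>}"
      unfolding acc using that by (intro measure_pmf.finite_measure_mono) auto
    then show ?thesis
      using tail by simp
  qed
qed

subsection \<open>Biases in the bisection tree\<close>

text \<open>A pair (a, b) stands for the interval \<open>{a<..b}\<close>, and \<open>node a b k i\<close> is the depth k node containing i
  of the bisection tree rooted there; below a singleton the node stays the same.\<close>

fun node :: "nat \<Rightarrow> nat \<Rightarrow> nat \<Rightarrow> nat \<Rightarrow> nat \<times> nat" where
  "node a b 0 i = (a, b)"
| "node a b (Suc k) i = (let m = (a + b) div 2 in if i \<le> m then node a m k i else node m b k i)"

text \<open>At a singleton the left half is empty, so the bias is 0; it is also 0 on a nonempty
  interval of mass 0, where the oracle answers uniformly.\<close>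

definition split_bias :: "nat pmf \<Rightarrow> nat \<times> nat \<Rightarrow> real" where
  "split_bias p = (\<lambda>(a, b). let m = (a + b) div 2 in
     measure_pmf.prob (cond_sample p {a<..b}) {a<..m} - real (m - a) / real (b - a))"

lemma node_bounds:
  "i \<in> {a<..b} \<Longrightarrow> node a b k i = (c, d) \<Longrightarrow> a \<le> c \<and> c < i \<and> i \<le> d \<and> d \<le> b"
proof (induction k arbitrary: a b)
  case (Suc k)
  let ?m = "(a + b) div 2"
  show ?case
  proof (cases "i \<le> ?m")
    case True
    with Suc.prems Suc.IH[of a ?m] show ?thesis by (simp add: Let_def) linarith
  next
    case False
    with Suc.prems Suc.IH[of ?m b] show ?thesis by (simp add: Let_def) linarith
  qed
qed auto

lemma prob_cond_sample:
  assumes "S \<noteq> {}" "finite S" "A \<subseteq> S"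
  shows "measure_pmf.prob (cond_sample p S) A =
    (if measure_pmf.prob p S = 0 then real (card A) / real (card S)
     else measure_pmf.prob p A / measure_pmf.prob p S)"
proof (cases "measure_pmf.prob p S = 0")
  case True
  have "S \<inter> A = A" using assms by auto
  with True assms show ?thesis
    by (simp add: cond_sample_def measure_pmf_of_set)
next
  case False
  then have "set_pmf p \<inter> S \<noteq> {}"
    by (metis measure_pmf_zero_iff)
  then have "pmf (cond_pmf p S) x = pmf p x / measure_pmf.prob p S" if "x \<in> A" for x
    using that assms by (auto simp: pmf_cond)
  moreover have "finite A" using assms finite_subset by auto
  ultimately show ?thesis
    using False by (simp add: cond_sample_def measure_measure_pmf_finite sum_divide_distrib)
qed

lemma split_bias_unif:
  assumes "a < b" "b \<le> n"
  shows "split_bias (unif n) (a, b) = 0"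
proof -
  let ?m = "(a + b) div 2"
  have I: "{1..n} \<inter> {a<..c} = {a<..c}" if "c \<le> n" for c using that by auto
  have u: "measure_pmf.prob (unif n) {a<..c} = real (c - a) / real n" if "c \<le> n" for c
    using assms that I[of c] unfolding unif_def by (subst measure_pmf_of_set) auto
  have m: "?m \<le> b" "?m \<le> n" using assms by auto
  have "measure_pmf.prob (cond_sample (unif n) {a<..b}) {a<..?m} = real (?m - a) / real (b - a)"
    using assms m by (subst prob_cond_sample) (auto simp: u)
  then show ?thesis
    by (simp add: split_bias_def Let_def)
qed

text \<open>Here x, y are the sizes of the two halves and u, v their masses scaled by N, so
  \<open>x\<^sup>2 / (x + u)\<close> is x times the potential 1 / (1 + u / x). The increase under
  splitting is exactly \<open>K\<^sup>2 / D\<close>, where the cross difference \<open>K\<close> is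
  the bias times \<open>s * w\<close>. The last two hypotheses say that each half holds at least a
  third of the node; they keep \<open>D\<close> from being too small.\<close>

lemma split_increment:
  fixes x y u v :: real
  assumes "x > 0" "y > 0" "u \<ge> 0" "v \<ge> 0" "u + v > 0" "3 * x \<ge> x + y" "3 * y \<ge> x + y"
  shows "x\<^sup>2 / (x + u) + y\<^sup>2 / (y + v)
    \<le> (x + y)\<^sup>2 / (x + y + (u + v)) + 9/2 * ((x + y) * (u / (u + v) - x / (x + y))\<^sup>2)"
proof -
  define w s where "w = x + y" and "s = u + v"
  have pos: "x + u > 0" "y + v > 0" "w + s > 0" "w > 0" "s > 0"
    using assms by (auto simp: w_def s_def)
  define K where "K = u * y - v * x"
  define D where "D = (x + u) * (y + v) * (w + s)"
  have "D > 0" using pos by (simp add: D_def)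
  have bias: "u / s - x / w = K / (s * w)"
    using pos by (simp add: field_simps) (simp add: w_def s_def K_def algebra_simps)
  have "a / X + b / Y - c / Z = (a * (Y * Z) + b * (X * Z) - c * (X * Y)) / (X * Y * Z)"
    if "X > 0" "Y > 0" "Z > 0" for a b c X Y Z :: real
    using that by (simp add: field_simps)
  from this[OF pos(1-3)] have "x\<^sup>2 / (x + u) + y\<^sup>2 / (y + v) - w\<^sup>2 / (w + s)
      = (x\<^sup>2 * ((y + v) * (w + s)) + y\<^sup>2 * ((x + u) * (w + s)) - w\<^sup>2 * ((x + u) * (y + v))) / D"
    unfolding D_def .
  also have num: "x\<^sup>2 * ((y + v) * (w + s)) + y\<^sup>2 * ((x + u) * (w + s)) - w\<^sup>2 * ((x + u) * (y + v))
      = K\<^sup>2"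
    unfolding w_def s_def K_def by algebra
  finally have eq: "x\<^sup>2 / (x + u) + y\<^sup>2 / (y + v) - w\<^sup>2 / (w + s) = K\<^sup>2 / D" .
  \<comment> \<open>The target is w (w + s) <= 9/2 (x + u) (y + v). It is compared by degree in the
    masses: \<open>A\<close>, \<open>B\<close> have degree 0, \<open>W\<close>, \<open>C\<close>
    degree 1, and \<open>E\<close> is the term u v of degree 2.\<close>
  have comb: "2 * A \<le> 9 * B \<Longrightarrow> W \<le> 3 * C \<Longrightarrow> 0 \<le> E \<Longrightarrow> 0 \<le> C \<Longrightarrow> A + W \<le> 9/2 * (B + C + E)"
    for A B C E W :: real
    by simp
  have "2 * w\<^sup>2 \<le> 9 * (x * y)"
  proof -
    \<comment> \<open>This is where 9/2 comes from: the bound is tight for a split in ratio 1 to 2,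
      which occurs for an interval of three points.\<close>
    have "0 \<le> (2 * x - y) * (2 * y - x)"
      using assms by (intro mult_nonneg_nonneg) auto
    then show ?thesis by (simp add: w_def power2_eq_square algebra_simps)
  qed
  moreover have "w * s \<le> 3 * (x * v + u * y)"
  proof -
    have "w * v \<le> 3 * x * v" "w * u \<le> 3 * y * u"
      using assms by (auto simp: w_def intro!: mult_right_mono)
    then show ?thesis by (simp add: s_def algebra_simps)
  qed
  moreover have "0 \<le> u * v" "0 \<le> x * v + u * y" using assms by simp_all
  ultimately have "w\<^sup>2 + w * s \<le> 9/2 * (x * y + (x * v + u * y) + u * v)"
    by (rule comb)
  then have "w * (w + s) \<le> 9/2 * ((x + u) * (y + v))"
    by (simp add: power2_eq_square algebra_simps)
  then have "w * (w + s) * (w + s) \<le> 9/2 * D"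
    using mult_right_mono[of "w * (w + s)" "9/2 * ((x + u) * (y + v))" "w + s"] pos
    by (simp add: D_def)
  moreover have "w * s\<^sup>2 \<le> w * (w + s) * (w + s)"
    using pos by (simp add: algebra_simps power2_eq_square)
  ultimately have "w * s\<^sup>2 \<le> 9/2 * D" by linarith
  then have le: "K\<^sup>2 / (9/2 * D) \<le> K\<^sup>2 / (w * s\<^sup>2)"
    using \<open>D > 0\<close> pos by (intro divide_left_mono) auto
  have "K\<^sup>2 / D = 9/2 * (K\<^sup>2 / (9/2 * D))"
    by simp
  also have "\<dots> \<le> 9/2 * (K\<^sup>2 / (w * s\<^sup>2))"
    by (rule mult_left_mono[OF le]) simp
  also have "K\<^sup>2 / (w * s\<^sup>2) = w * (K / (s * w))\<^sup>2"
    using pos by (simp add: power_divide power_mult_distrib power2_eq_square)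
  finally have "K\<^sup>2 / D \<le> 9/2 * (w * (K / (s * w))\<^sup>2)" .
  then show ?thesis
    using eq unfolding bias[symmetric] w_def[symmetric] s_def[symmetric] by (smt (verit))
qed

text \<open>With N = n and \<open>w = b - a\<close>, the first term on the right is w times the potential \<open>1 / (1 + M)\<close> at
  the root, where M is the mass of the interval relative to uniform; the left-hand side is the
  potential summed over the leaves.\<close>

lemma sum_inverse_le_split_bias:
  fixes p :: "nat pmf" and N :: real
  assumes "N > 0" "a < b" "b - a \<le> 2 ^ k"
  shows "(\<Sum>i\<in>{a<..b}. 1 / (1 + N * pmf p i))
    \<le> (real (b - a))\<^sup>2 / (real (b - a) + N * measure_pmf.prob p {a<..b})
      + 9/2 * (\<Sum>j<k. \<Sum>i\<in>{a<..b}. (split_bias p (node a b j i))\<^sup>2)"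
  using assms(2,3)
proof (induction k arbitrary: a b)
  case 0
  then have "b = Suc a" by simp
  moreover have "{a<..Suc a} = {Suc a}" by auto
  ultimately show ?case
    by (simp add: measure_pmf_single)
next
  case (Suc k)
  let ?P = "\<lambda>a b. measure_pmf.prob p {a<..b}"
  let ?g = "\<lambda>I. (split_bias p I)\<^sup>2"
  let ?G = "\<lambda>a b k. \<Sum>j<k. \<Sum>i\<in>{a<..b}. ?g (node a b j i)"
  show ?case
  proof (cases "b = Suc a")
    case True
    moreover have "{a<..Suc a} = {Suc a}" by auto
    \<comment> \<open>A leaf reached before the depth is exhausted: the potential already agrees,
      and the bias sum only adds nonnegative terms.\<close>
    moreover have "0 \<le> ?G a b (Suc k)" by (intro sum_nonneg) simp
    ultimately show ?thesis
      by (simp add: measure_pmf_single)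
  next
    case False
    define m where "m = (a + b) div 2"
    have m: "a < m" "m < b" "m - a \<le> 2 ^ k" "b - m \<le> 2 ^ k"
      "3 * (m - a) \<ge> b - a" "3 * (b - m) \<ge> b - a"
      using Suc.prems False by (auto simp: m_def)
    have un: "{a<..b} = {a<..m} \<union> {m<..b}" "{a<..m} \<inter> {m<..b} = {}"
      using m by auto
    have sum_un: "(\<Sum>i\<in>{a<..b}. f i) = (\<Sum>i\<in>{a<..m}. f i) + (\<Sum>i\<in>{m<..b}. f i)" for f :: "nat \<Rightarrow> real"
      using un by (simp add: sum.union_disjoint)
    have P: "?P a b = ?P a m + ?P m b"
      by (simp add: measure_measure_pmf_finite sum_un)
    \<comment> \<open>Depth 0 sees the root from each of its b - a points; every further depth
      separates into the two subtrees.\<close>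
    have G: "?G a b (Suc k) = real (b - a) * ?g (a, b) + ?G a m k + ?G m b k"
    proof -
      have "?G a b (Suc k) = real (b - a) * ?g (a, b) + (\<Sum>j<k. \<Sum>i\<in>{a<..b}. ?g (node a b (Suc j) i))"
        by (simp add: sum.lessThan_Suc_shift del: node.simps(2) sum.lessThan_Suc)
      moreover have "(\<Sum>i\<in>{a<..b}. ?g (node a b (Suc j) i)) =
          (\<Sum>i\<in>{a<..m}. ?g (node a m j i)) + (\<Sum>i\<in>{m<..b}. ?g (node m b j i))" for j
        unfolding sum_un
        by (intro arg_cong2[where f = "(+)"] sum.cong) (auto simp: Let_def m_def[symmetric])
      ultimately show ?thesis by (simp add: sum.distrib)
    qed
    let ?x = "real (m - a)" and ?y = "real (b - m)"
    have xy: "real (b - a) = ?x + ?y" using m by (simp add: of_nat_diff)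
    have xy_le: "3 * ?x \<ge> ?x + ?y" "3 * ?y \<ge> ?x + ?y"
      using of_nat_mono[OF m(5), where 'a = real] of_nat_mono[OF m(6), where 'a = real] xy by simp_all
    have "?x\<^sup>2 / (?x + N * ?P a m) + ?y\<^sup>2 / (?y + N * ?P m b)
        \<le> (?x + ?y)\<^sup>2 / (?x + ?y + N * ?P a b) + 9/2 * ((?x + ?y) * ?g (a, b))"
    \<comment> \<open>\<open>split_increment\<close> needs positive total mass. With mass 0 both
      potential terms reduce to the size of the node.\<close>
    proof (cases "?P a b = 0")
      case True
      then have "?P a m = 0" "?P m b = 0"
        using P measure_nonneg[of p "{a<..m}"] measure_nonneg[of p "{m<..b}"] by linarith+
      then show ?thesis
        using True m by (simp add: power2_eq_square)
    next
      case nz: False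
      have "?P a b > 0" using nz by (simp add: measure_le_0_iff order_less_le)
      then have s: "N * ?P a m + N * ?P m b > 0"
        using P assms(1) by (simp flip: distrib_left)
      have "split_bias p (a, b) = ?P a m / ?P a b - ?x / (?x + ?y)"
      proof -
        have "measure_pmf.prob (cond_sample p {a<..b}) {a<..m} = ?P a m / ?P a b"
          using nz m by (subst prob_cond_sample) auto
        then show ?thesis
          unfolding xy[symmetric] by (simp add: split_bias_def Let_def m_def)
      qed
      also have "?P a m / ?P a b = N * ?P a m / (N * ?P a m + N * ?P m b)"
        using assms(1) by (simp add: P flip: distrib_left)
      finally show ?thesis
        using split_increment[of ?x ?y "N * ?P a m" "N * ?P m b"] m xy_le s assms(1)
        by (simp add: P distrib_left)
    qed
    then show ?thesis
      using Suc.IH[of a m] Suc.IH[of m b] m(1-4)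
      unfolding G xy sum_un[of "\<lambda>i. 1 / (1 + N * pmf p i)"] distrib_left by linarith
  qed
qed

text \<open>The potential is n / 2 at the root, where the relative mass is 1. At the leaves it is at
  least \<open>n / 2 + n * d\<^sup>2 / 2\<close>, by convexity of 1 / (1 + q). The squared biases
  must account for the difference.\<close>

lemma sum_split_bias_ge:
  fixes p :: "nat pmf"
  assumes "n \<ge> 1" "n \<le> 2 ^ k" "dist_on n p"
  shows "real n * (dtv n p (unif n))\<^sup>2 \<le> 9 * (\<Sum>j<k. \<Sum>i\<in>{1..n}. (split_bias p (node 0 n j i))\<^sup>2)"
proof -
  define d where "d = dtv n p (unif n)"
  define q where "q = (\<lambda>i. real n * pmf p i)"
  have I: "{0<..n} = {1..n}" by auto
  have one: "measure_pmf.prob p {1..n} = 1"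
    using assms(3) unfolding dist_on_def by (simp add: measure_pmf.prob_eq_1 AE_measure_pmf_iff subset_eq)
  then have "(\<Sum>i\<in>{1..n}. pmf p i) = 1"
    by (simp add: measure_measure_pmf_finite)
  then have q: "(\<Sum>i\<in>{1..n}. q i) = real n"
    by (simp add: q_def flip: sum_distrib_left)
  have "real n * \<bar>pmf p i - pmf (unif n) i\<bar> = \<bar>1 - q i\<bar>" if "i \<in> {1..n}" for i
  proof -
    have "real n * \<bar>pmf p i - pmf (unif n) i\<bar> = \<bar>real n * (pmf p i - pmf (unif n) i)\<bar>"
      by (simp add: abs_mult)
    also have "real n * (pmf p i - pmf (unif n) i) = q i - 1"
      using that by (simp add: unif_def q_def algebra_simps)
    finally show ?thesis by simp
  qed
  then have absq: "(\<Sum>i\<in>{1..n}. \<bar>1 - q i\<bar>) = 2 * real n * d"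
    unfolding d_def dtv_def by (simp add: sum_distrib_left)
  have pt: "1/2 + (1 - q i) / 4 + (2 * d * \<bar>1 - q i\<bar> - d\<^sup>2 * (1 + q i)) / 4 \<le> 1 / (1 + q i)" for i
  proof -
    have q0: "1 + q i > 0" by (simp add: q_def add_pos_nonneg)
    \<comment> \<open>a tangent-line form of Cauchy--Schwarz, which turns the triangular discrimination into \<open>d\<^sup>2\<close>\<close>
    have "0 \<le> (\<bar>1 - q i\<bar> - d * (1 + q i))\<^sup>2" by simp
    also have "\<dots> = (1 - q i)\<^sup>2 - (2 * d * \<bar>1 - q i\<bar> - d\<^sup>2 * (1 + q i)) * (1 + q i)"
      by (simp add: power2_diff power_mult_distrib algebra_simps power2_eq_square)
    finally have "2 * d * \<bar>1 - q i\<bar> - d\<^sup>2 * (1 + q i) \<le> (1 - q i)\<^sup>2 / (1 + q i)"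
      using q0 by (simp add: pos_le_divide_eq)
    \<comment> \<open>Expansion at q = 1 with exact remainder; the linear term vanishes in the sum
      because \<open>q\<close> averages to 1.\<close>
    moreover have "1 / (1 + q i) = 1/2 + (1 - q i) / 4 + (1 - q i)\<^sup>2 / (1 + q i) / 4"
      using q0 by (simp add: field_simps power2_eq_square)
    ultimately show ?thesis by (smt (verit) divide_right_mono)
  qed
  have low: "(\<Sum>i\<in>{1..n}. 1/2 + (1 - q i) / 4 + (2 * d * \<bar>1 - q i\<bar> - d\<^sup>2 * (1 + q i)) / 4)
      \<le> (\<Sum>i\<in>{1..n}. 1 / (1 + q i))"
    by (rule sum_mono) (rule pt)
  have "(\<Sum>i\<in>{1..n}. 1/2 + (1 - q i) / 4 + (2 * d * \<bar>1 - q i\<bar> - d\<^sup>2 * (1 + q i)) / 4)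
      = real n / 2 + real n * d\<^sup>2 / 2"
  proof -
    have low: "(\<Sum>i\<in>{1..n}. 1/2 + (1 - q i) / 4 + (2 * d * \<bar>1 - q i\<bar> - d\<^sup>2 * (1 + q i)) / 4)
      \<le> (\<Sum>i\<in>{1..n}. 1 / (1 + q i))"
    by (rule sum_mono) (rule pt)
  have "(\<Sum>i\<in>{1..n}. 1/2 + (1 - q i) / 4 + (2 * d * \<bar>1 - q i\<bar> - d\<^sup>2 * (1 + q i)) / 4)
      = real n / 2 + (real n - (\<Sum>i\<in>{1..n}. q i)) / 4
        + (2 * d * (\<Sum>i\<in>{1..n}. \<bar>1 - q i\<bar>) - d\<^sup>2 * (real n + (\<Sum>i\<in>{1..n}. q i))) / 4"
      by (simp add: sum.distrib sum_subtractf flip: sum_divide_distrib sum_distrib_left)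
    \<comment> \<open>The last part contributes (2 d * 2 n d - d^2 * 2 n) / 4 = n d^2 / 2.\<close>
    then show ?thesis
      unfolding q absq by (simp add: power2_eq_square algebra_simps)
  qed
  moreover have "(\<Sum>i\<in>{1..n}. 1 / (1 + real n * pmf p i))
      \<le> real n / 2 + 9/2 * (\<Sum>j<k. \<Sum>i\<in>{1..n}. (split_bias p (node 0 n j i))\<^sup>2)"
    using sum_inverse_le_split_bias[of "real n" 0 n k p] assms one
    unfolding I by (simp add: power2_eq_square)
  ultimately show ?thesis
    using low unfolding d_def[symmetric] by (simp add: q_def)
qed

subsection \<open>The tester\<close>

text \<open>Drawing a uniform point i and taking its node at a uniform depth picks nodes of one
  depth in proportion to their size, the weighting used in \<open>sum_split_bias_ge\<close>.\<close>

definition trial :: "nat \<Rightarrow> real \<Rightarrow> nat \<Rightarrow> nat \<Rightarrow> strategy" where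
  "trial R \<tau> L n =
     map_pmf (\<lambda>(j, i). case node 0 n j i of (a, b) \<Rightarrow> freq_test R \<tau> ({a<..b}, {a<..(a + b) div 2}))
       (pmf_of_set ({..<L} \<times> {1..n}))"

lemma trial_queries:
  assumes "L \<ge> 1" "n \<ge> 1" "(Qs, D) \<in> set_pmf (trial R \<tau> L n)"
  shows "set Qs \<subseteq> {S. S \<noteq> {} \<and> S \<subseteq> {1..n}} \<and> length Qs = R"
proof -
  have "finite ({..<L} \<times> {1..n})" "{..<L} \<times> {1..n} \<noteq> {}"
    using assms by (auto simp: lessThan_empty_iff)
  with assms(3) have "(Qs, D) \<in> (\<lambda>(j, i). case node 0 n j i of
      (a, b) \<Rightarrow> freq_test R \<tau> ({a<..b}, {a<..(a + b) div 2})) ` ({..<L} \<times> {1..n})"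
    unfolding trial_def set_map_pmf by (subst (asm) set_pmf_of_set)
  then obtain j i where ji: "i \<in> {1..n}"
      "(Qs, D) = (case node 0 n j i of (a, b) \<Rightarrow> freq_test R \<tau> ({a<..b}, {a<..(a + b) div 2}))"
    by (elim imageE SigmaE) simp
  obtain a b where ab: "node 0 n j i = (a, b)" by fastforce
  have "a < i \<and> i \<le> b \<and> b \<le> n"
    using node_bounds[of i 0 n j a b] ji(1) ab by auto
  moreover have "Qs = replicate R {a<..b}"
    using ji(2) ab by (simp add: freq_test_def)
  ultimately show ?thesis by auto
qed

lemma pmf_run_trial:
  assumes "L \<ge> 1" "n \<ge> 1"
  shows "pmf (run (trial R \<tau> L n) p) True =
    (\<Sum>(j, i)\<in>{..<L} \<times> {1..n}. case node 0 n j i of (a, b) \<Rightarrow>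
       pmf (case freq_test R \<tau> ({a<..b}, {a<..(a + b) div 2}) of (Qs, D) \<Rightarrow> map_pmf D (answers p Qs)) True)
    / (real L * real n)"
proof -
  have "finite ({..<L} \<times> {1..n})" "{..<L} \<times> {1..n} \<noteq> {}"
    using assms by (auto simp: lessThan_empty_iff)
  then show ?thesis
    unfolding run_def trial_def bind_map_pmf
    by (subst pmf_bind_pmf_of_set) (auto simp: case_prod_unfold card_cartesian_product)
qed

lemma freq_test_node:
  fixes p :: "nat pmf" and R n j i :: nat and \<tau> :: real
  assumes "R > 0" "\<tau> \<ge> 0" "i \<in> {1..n}"
  defines "acc \<equiv> case node 0 n j i of (a, b) \<Rightarrow>
       pmf (case freq_test R \<tau> ({a<..b}, {a<..(a + b) div 2}) of (Qs, D) \<Rightarrow> map_pmf D (answers p Qs)) True"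
  shows "split_bias p (node 0 n j i) = 0 \<Longrightarrow> acc \<ge> 1 - 2 * exp (- 2 * real R * \<tau>\<^sup>2)"
    and "\<bar>split_bias p (node 0 n j i)\<bar> \<ge> 2 * \<tau> \<Longrightarrow> acc \<le> 2 * exp (- 2 * real R * \<tau>\<^sup>2)"
proof -
  obtain a b where ab: "node 0 n j i = (a, b)" by fastforce
  let ?S = "{a<..b}" and ?A = "{a<..(a + b) div 2}"
  have bias: "split_bias p (node 0 n j i) =
      measure_pmf.prob (cond_sample p ?S) ?A - real (card ?A) / real (card ?S)"
    by (simp add: ab split_bias_def Let_def)
  have acc: "acc = pmf (case freq_test R \<tau> (?S, ?A) of (Qs, D) \<Rightarrow> map_pmf D (answers p Qs)) True"
    by (simp add: acc_def ab)
  show "split_bias p (node 0 n j i) = 0 \<Longrightarrow> acc \<ge> 1 - 2 * exp (- 2 * real R * \<tau>\<^sup>2)"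
    unfolding bias acc by (rule freq_test_cases(1)[OF assms(1,2)]) simp
  show "\<bar>split_bias p (node 0 n j i)\<bar> \<ge> 2 * \<tau> \<Longrightarrow> acc \<le> 2 * exp (- 2 * real R * \<tau>\<^sup>2)"
    unfolding bias acc by (rule freq_test_cases(2)[OF assms(1,2)])
qed

lemma trial_unif:
  assumes "L \<ge> 1" "n \<ge> 1" "R > 0" "\<tau> \<ge> 0"
  shows "pmf (run (trial R \<tau> L n) (unif n)) True \<ge> 1 - 2 * exp (- 2 * real R * \<tau>\<^sup>2)"
proof -
  let ?e = "1 - 2 * exp (- 2 * real R * \<tau>\<^sup>2)"
  let ?acc = "\<lambda>(j, i). case node 0 n j i of (a, b) \<Rightarrow>
       pmf (case freq_test R \<tau> ({a<..b}, {a<..(a + b) div 2}) of (Qs, D) \<Rightarrow> map_pmf D (answers (unif n) Qs)) True"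
  have bias: "split_bias (unif n) (node 0 n j i) = 0" if "i \<in> {1..n}" for j i
  proof -
    obtain a b where ab: "node 0 n j i = (a, b)" by fastforce
    then have "a < b \<and> b \<le> n"
      using node_bounds[of i 0 n j a b] that by auto
    then show ?thesis
      using split_bias_unif ab by simp
  qed
  have "?e * (real L * real n) = (\<Sum>x\<in>{..<L} \<times> {1..n}. ?e)"
    by (simp add: card_cartesian_product)
  also have "\<dots> \<le> (\<Sum>x\<in>{..<L} \<times> {1..n}. ?acc x)"
    by (intro sum_mono, clarify) (rule freq_test_node(1)[OF assms(3,4)], use bias in auto)
  finally show ?thesis
    using assms unfolding pmf_run_trial[OF assms(1,2)] by (simp add: pos_le_divide_eq)
qed

text \<open>A pair in \<open>B\<close> is accepted with probability at most 1/2, any other with at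
  most 1; the claim is the average over all pairs.\<close>

lemma trial_far:
  fixes p :: "nat pmf" and R L n :: nat and \<tau> :: real
  assumes "L \<ge> 1" "n \<ge> 1" "R > 0" "\<tau> \<ge> 0" "2 * exp (- 2 * real R * \<tau>\<^sup>2) \<le> 1 / 2"
  defines "B \<equiv> {(j, i) \<in> {..<L} \<times> {1..n}. \<bar>split_bias p (node 0 n j i)\<bar> \<ge> 2 * \<tau>}"
  shows "pmf (run (trial R \<tau> L n) p) True \<le> 1 - real (card B) / (2 * (real L * real n))"
proof -
  let ?X = "{..<L} \<times> {1..n}"
  let ?acc = "\<lambda>(j, i). case node 0 n j i of (a, b) \<Rightarrow>
       pmf (case freq_test R \<tau> ({a<..b}, {a<..(a + b) div 2}) of (Qs, D) \<Rightarrow> map_pmf D (answers p Qs)) True"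
  have B: "B \<subseteq> ?X" by (auto simp: B_def)
  have "?acc x \<le> 1 - indicator B x / 2" if "x \<in> ?X" for x
  proof (cases "x \<in> B")
    case True
    obtain j i where x: "x = (j, i)" by fastforce
    have "?acc x \<le> 2 * exp (- 2 * real R * \<tau>\<^sup>2)"
      using True unfolding x case_prod_conv
      by (intro freq_test_node(2)[OF assms(3,4)]) (auto simp: B_def)
    then show ?thesis
      using True assms(5) by simp
  next
    case False
    then show ?thesis
      by (auto simp: pmf_le_1 split: prod.split)
  qed
  then have "(\<Sum>x\<in>?X. ?acc x) \<le> (\<Sum>x\<in>?X. 1 - indicator B x / 2)"
    by (rule sum_mono)
  also have "\<dots> = real L * real n - real (card B) / 2"
    using B by (simp add: sum_subtractf card_cartesian_product indicator_def sum.If_cases Int_absorb1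
        flip: sum_divide_distrib)
  finally show ?thesis
    using assms(1,2) unfolding pmf_run_trial[OF assms(1,2)] by (simp add: field_simps)
qed

section \<open>Dyadic pigeonhole and combination of trials\<close>

text \<open>If every level failed, summing \<open>Y\<close> over dyadic layers would give less than
  \<gamma> |X| / 2 from the \<Lambda> + 1 levels together, plus at most |X| / 2^(\<Lambda> + 1) <=
  \<gamma> |X| / 2 from smaller values, contradicting the mean.\<close>

lemma exists_dyadic_level:
  fixes Y :: "'a \<Rightarrow> real" and \<gamma> :: real and \<Lambda> :: nat
  assumes "finite X" "\<And>x. x \<in> X \<Longrightarrow> 0 \<le> Y x" "\<And>x. x \<in> X \<Longrightarrow> Y x \<le> 1"
    and mean: "\<gamma> * real (card X) \<le> sum Y X" and "1 \<le> \<gamma> * 2 ^ \<Lambda>"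
  shows "\<exists>l\<le>\<Lambda>. \<gamma> * real (card X) * 2 ^ l \<le>
    2 * (real \<Lambda> + 1) * real (card {x \<in> X. 1 / 2 ^ Suc l \<le> Y x})"
proof (rule ccontr)
  assume neg: "\<not> ?thesis"
  let ?B = "\<lambda>l. {x \<in> X. 1 / 2 ^ Suc l \<le> Y x}"
  have pt: "Y x \<le> 1 / 2 ^ Suc \<Lambda> + (\<Sum>l\<le>\<Lambda>. (1 / 2 ^ l) * indicator (?B l) x)" if x: "x \<in> X" for x
  proof (cases "1 / 2 ^ Suc \<Lambda> \<le> Y x")
    case True
    \<comment> \<open>Minimality gives the matching upper bound 2^-l for \<open>Y x\<close>; for l =
      0 it is the bound \<open>Y x \<le> 1\<close>.\<close>
    define l where "l = (LEAST l. 1 / 2 ^ Suc l \<le> Y x)"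
    have l: "1 / 2 ^ Suc l \<le> Y x" "l \<le> \<Lambda>"
      using LeastI[of "\<lambda>l. 1 / 2 ^ Suc l \<le> Y x", OF True] Least_le[of "\<lambda>l. 1 / 2 ^ Suc l \<le> Y x", OF True]
      by (simp_all add: l_def)
    have "Y x \<le> 1 / 2 ^ l"
    proof (cases l)
      case 0
      then show ?thesis using assms(3)[OF x] by simp
    next
      case (Suc l')
      then have "\<not> 1 / 2 ^ Suc l' \<le> Y x"
        using not_less_Least[of l' "\<lambda>l. 1 / 2 ^ Suc l \<le> Y x"] by (simp add: l_def)
      then show ?thesis using Suc by simp
    qed
    also have "\<dots> = (1 / 2 ^ l) * indicator (?B l) x"
      using l(1) x by simp
    also have "\<dots> \<le> (\<Sum>l\<le>\<Lambda>. (1 / 2 ^ l) * indicator (?B l) x)"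
      using l(2) by (intro member_le_sum) auto
    finally show ?thesis
      by (smt (verit) zero_le_divide_1_iff zero_le_power)
  next
    case False
    moreover have "0 \<le> (\<Sum>l\<le>\<Lambda>. (1 / 2 ^ l) * indicator (?B l) x :: real)"
      by (intro sum_nonneg) auto
    ultimately show ?thesis by linarith
  qed
  have "\<gamma> > 0"
    using assms(5) by (smt (verit) mult_nonpos_nonneg zero_le_power)
  have card: "card X > 0"
  proof (rule ccontr)
    assume "\<not> card X > 0"
    with neg show False by auto
  qed
  have lev: "real (card (?B l)) / 2 ^ l < \<gamma> * real (card X) / (2 * (real \<Lambda> + 1))" if "l \<le> \<Lambda>" for l
  proof -
    have "2 * (real \<Lambda> + 1) * real (card (?B l)) < \<gamma> * real (card X) * 2 ^ l"
      using neg that by (meson not_le)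
    then show ?thesis by (simp add: field_simps)
  qed
  have "sum Y X \<le> (\<Sum>x\<in>X. 1 / 2 ^ Suc \<Lambda> + (\<Sum>l\<le>\<Lambda>. (1 / 2 ^ l) * indicator (?B l) x))"
    by (intro sum_mono pt)
  also have "\<dots> = real (card X) * (1 / 2 ^ Suc \<Lambda>) + (\<Sum>x\<in>X. \<Sum>l\<le>\<Lambda>. (1 / 2 ^ l) * indicator (?B l) x)"
    by (simp add: sum.distrib)
  also have "(\<Sum>x\<in>X. \<Sum>l\<le>\<Lambda>. (1 / 2 ^ l) * indicator (?B l) x) =
      (\<Sum>l\<le>\<Lambda>. \<Sum>x\<in>X. (1 / 2 ^ l) * (indicator (?B l) x :: real))"
    by (rule sum.swap)
  also have "\<dots> = (\<Sum>l\<le>\<Lambda>. real (card (?B l)) / 2 ^ l)"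
  proof (intro sum.cong refl)
    fix l
    have "(\<Sum>x\<in>X. (indicator (?B l) x :: real)) = real (card (?B l))"
      using assms(1) by (simp add: indicator_def sum.If_cases Int_def)
    then show "(\<Sum>x\<in>X. (1 / 2 ^ l) * (indicator (?B l) x :: real)) = real (card (?B l)) / 2 ^ l"
      by (simp flip: sum_distrib_left sum_divide_distrib)
  qed
  also have "\<dots> < (\<Sum>l\<le>\<Lambda>. \<gamma> * real (card X) / (2 * (real \<Lambda> + 1)))"
    using lev by (intro sum_strict_mono) auto
  also have "\<dots> = \<gamma> * real (card X) / 2"
    by (simp add: field_simps)
  finally have "sum Y X < real (card X) * (1 / 2 ^ Suc \<Lambda>) + \<gamma> * real (card X) / 2"
    by simp
  moreover have "real (card X) * (1 / 2 ^ Suc \<Lambda>) \<le> \<gamma> * real (card X) / 2"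
  proof -
    have "1 / 2 ^ Suc \<Lambda> \<le> \<gamma> / 2"
      using assms(5) by (simp add: field_simps)
    then show ?thesis
      using mult_left_mono[of "1 / 2 ^ Suc \<Lambda>" "\<gamma> / 2" "real (card X)"] by (simp add: mult.commute)
  qed
  ultimately show False
    using mean by linarith
qed

lemma prod_list_ge_union_bound:
  fixes \<eta> :: real
  assumes "\<And>x. x \<in> set xs \<Longrightarrow> 1 - \<eta> \<le> x \<and> x \<le> 1" "0 \<le> \<eta>" "\<eta> \<le> 1"
  shows "1 - real (length xs) * \<eta> \<le> prod_list xs \<and> prod_list xs \<le> 1 \<and> 0 \<le> prod_list xs"
  using assms(1)
proof (induction xs)
  case (Cons x xs)
  then have IH: "1 - real (length xs) * \<eta> \<le> prod_list xs" "prod_list xs \<le> 1" "0 \<le> prod_list xs"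
    and x: "1 - \<eta> \<le> x" "x \<le> 1" by auto
  have "(1 - x) * prod_list xs \<le> (1 - x) * 1"
    using IH x by (intro mult_left_mono) auto
  then have "prod_list xs - \<eta> \<le> x * prod_list xs"
    using x by (simp add: algebra_simps)
  then show ?case
    using IH x assms(2,3) by (simp add: algebra_simps mult_le_one) 
qed simp

text \<open>For soundness one good level suffices: the factors of all other levels are at most
  1.\<close>

lemma prod_list_concat_replicate_le:
  fixes a :: "'a \<Rightarrow> real"
  assumes "\<And>x. 0 \<le> a x \<and> a x \<le> 1" "y \<in> set ys"
  shows "prod_list (map a (concat (map (\<lambda>x. replicate (t x) x) ys))) \<le> a y ^ t y"
proof -
  have eq: "prod_list (map a (concat (map (\<lambda>x. replicate (t x) x) zs))) = prod_list (map (\<lambda>x. a x ^ t x) zs)" for zs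
    by (induction zs) (simp_all add: prod_list_replicate)
  have unit: "0 \<le> prod_list (map (\<lambda>x. a x ^ t x) zs) \<and> prod_list (map (\<lambda>x. a x ^ t x) zs) \<le> 1" for zs
    by (induction zs) (use assms(1) in \<open>auto intro!: mult_le_one power_le_one\<close>)
  obtain us vs where "ys = us @ y # vs"
    using assms(2) by (meson split_list)
  then have "prod_list (map (\<lambda>x. a x ^ t x) ys) =
      a y ^ t y * (prod_list (map (\<lambda>x. a x ^ t x) us) * prod_list (map (\<lambda>x. a x ^ t x) vs))"
    by simp
  also have "\<dots> \<le> a y ^ t y"
    using assms(1) unit[of us] unit[of vs] by (intro mult_left_le) (auto intro!: mult_le_one)
  finally show ?thesis
    by (simp only: eq)
qed

text \<open>With x the reciprocal of the mean square bias, rounded up to \<open>2 ^ \<Lambda>\<close>, level l is tuned to nodes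
  of squared bias about \<open>2 ^ - l\<close>: it costs order x samples, up to logarithms, whatever l is.
  The factor \<open>Suc \<Lambda>\<close> in the number of repetitions pays for the choice of the level, the one in the
  number of samples for the union bound over all trials.\<close>

definition repetitions :: "nat \<Rightarrow> nat \<Rightarrow> nat" where
  "repetitions \<Lambda> l = 8 * Suc \<Lambda> * 2 ^ (\<Lambda> - l)"

definition samples :: "nat \<Rightarrow> nat \<Rightarrow> nat" where
  "samples \<Lambda> l = 20 * Suc \<Lambda> * 2 ^ l"

text \<open>Chosen so that \<open>(2 * threshold l)\<^sup>2\<close> is 1 / 2^(l + 1), the cutoff of
  level l in \<open>exists_dyadic_level\<close>.\<close>

definition threshold :: "nat \<Rightarrow> real" where
  "threshold l = sqrt (1 / 2 ^ (l + 3))"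

definition levels :: "nat \<Rightarrow> nat list" where
  "levels \<Lambda> = concat (map (\<lambda>l. replicate (repetitions \<Lambda> l) l) [0..<Suc \<Lambda>])"

definition tester :: "nat \<Rightarrow> nat \<Rightarrow> nat \<Rightarrow> strategy" where
  "tester \<Lambda> L n =
     conj_strategies (map (\<lambda>l. trial (samples \<Lambda> l) (threshold l) L n) (levels \<Lambda>))"

lemma threshold_nonneg: "threshold l \<ge> 0"
  by (simp add: threshold_def)

lemma samples_pos: "samples \<Lambda> l > 0"
  by (simp add: samples_def)

text \<open>The factor 20 makes the exponent -5 (\<Lambda> + 1). Base 48 = 6 * 8 outgrows the number
  of trials, at most 8 * 8^\<Lambda>, and leaves total error 1/3.\<close>

lemma samples_threshold: "2 * exp (- 2 * real (samples \<Lambda> l) * (threshold l)\<^sup>2) \<le> 2 / 48 ^ Suc \<Lambda>"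
proof -
  have "- 2 * real (samples \<Lambda> l) * (threshold l)\<^sup>2 = - (real (Suc \<Lambda>) * 5)"
    by (simp add: samples_def threshold_def power_add field_simps)
  then have "exp (- 2 * real (samples \<Lambda> l) * (threshold l)\<^sup>2) = 1 / exp 5 ^ Suc \<Lambda>"
    by (simp only: exp_minus exp_of_nat_mult inverse_eq_divide)
  moreover have "(48::real) \<le> exp 5"
  proof -
    have "(48::real) \<le> (1 + 1/2) ^ 10" by (simp add: power_divide)
    also have "\<dots> \<le> exp (1/2) ^ 10"
      by (intro power_mono exp_ge_add_one_self) simp
    also have "\<dots> = exp 5" by (simp flip: exp_of_nat_mult)
    finally show ?thesis .
  qed
  then have "(48::real) ^ Suc \<Lambda> \<le> exp 5 ^ Suc \<Lambda>"
    by (intro power_mono) auto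
  ultimately show ?thesis
    by (simp add: frac_le del: power_Suc)
qed

text \<open>Since 2^(\<Lambda> - l) * 2^l = 2^\<Lambda>, each of the \<Lambda> + 1 levels costs the
  same, with 160 = 8 * 20.\<close>

lemma tester_queries:
  assumes "L \<ge> 1" "n \<ge> 1" "(Qs, D) \<in> set_pmf (tester \<Lambda> L n)"
  shows "set Qs \<subseteq> {S. S \<noteq> {} \<and> S \<subseteq> {1..n}}" "length Qs = 160 * Suc \<Lambda> ^ 3 * 2 ^ \<Lambda>"
proof -
  have *: "set Qs \<subseteq> {S. S \<noteq> {} \<and> S \<subseteq> {1..n}} \<and> length Qs = sum_list (map (samples \<Lambda>) (levels \<Lambda>))"
    using assms(3) unfolding tester_def
    by (rule conj_strategies_queries) (rule trial_queries[OF assms(1,2)])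
  then show "set Qs \<subseteq> {S. S \<noteq> {} \<and> S \<subseteq> {1..n}}" ..
  have sum: "sum_list (map (samples \<Lambda>) (concat (map (\<lambda>l. replicate (repetitions \<Lambda> l) l) ls))) =
      length ls * (160 * Suc \<Lambda> ^ 2 * 2 ^ \<Lambda>)" if "set ls \<subseteq> {..\<Lambda>}" for ls
    using that
  proof (induction ls)
    case (Cons l ls)
    then have "(2::nat) ^ (\<Lambda> - l) * 2 ^ l = 2 ^ \<Lambda>"
      by (simp flip: power_add)
    moreover have "8 * a * b * (20 * a * c) = 160 * a ^ 2 * (b * c)" for a b c :: nat
      by (simp add: power2_eq_square)
    ultimately have "repetitions \<Lambda> l * samples \<Lambda> l = 160 * Suc \<Lambda> ^ 2 * 2 ^ \<Lambda>"
      unfolding repetitions_def samples_def by metis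
    with Cons show ?case
      by (simp add: sum_list_replicate)
  qed simp
  have "set [0..<Suc \<Lambda>] \<subseteq> {..\<Lambda>}" by auto
  moreover have "a * (160 * a ^ 2 * c) = 160 * a ^ 3 * c" for a c :: nat
    by (simp add: power2_eq_square power3_eq_cube)
  ultimately show "length Qs = 160 * Suc \<Lambda> ^ 3 * 2 ^ \<Lambda>"
    using * sum[of "[0..<Suc \<Lambda>]"] unfolding levels_def by (simp only: length_upt diff_zero)
qed

text \<open>A union bound over all trials, each of which rejects the uniform distribution with
  probability at most \<open>\<eta>\<close>.\<close>

lemma tester_unif:
  assumes "L \<ge> 1" "n \<ge> 1"
  shows "pmf (run (tester \<Lambda> L n) (unif n)) True \<ge> 2 / 3"
proof -
  define \<eta> :: real where "\<eta> = 2 / 48 ^ Suc \<Lambda>"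
  have len: "real (length (levels \<Lambda>)) * \<eta> \<le> 1 / 3"
  proof -
    have le2: "Suc \<Lambda> \<le> 2 ^ \<Lambda>"
      by (simp add: Suc_leI)
    have "length (levels \<Lambda>) = (\<Sum>l\<leftarrow>[0..<Suc \<Lambda>]. repetitions \<Lambda> l)"
      by (simp add: levels_def length_concat o_def)
    \<comment> \<open>Crude bounds are enough: \<Lambda> + 1 is replaced by 2^\<Lambda> here and
      again in the number of levels.\<close>
    also have "\<dots> \<le> (\<Sum>l\<leftarrow>[0..<Suc \<Lambda>]. 8 * 2 ^ \<Lambda> * 2 ^ \<Lambda>)"
      unfolding repetitions_def using le2 by (intro sum_list_mono mult_mono power_increasing) auto
    also have "\<dots> = Suc \<Lambda> * (8 * 2 ^ \<Lambda> * 2 ^ \<Lambda>)"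
      by (simp add: sum_list_triv del: upt_Suc)
    also have "\<dots> \<le> 2 ^ \<Lambda> * (8 * 2 ^ \<Lambda> * 2 ^ \<Lambda>)"
      using le2 by (rule mult_right_mono) simp
    also have "\<dots> = 8 * (2 ^ \<Lambda> * 2 ^ \<Lambda> * 2 ^ \<Lambda>)"
      by simp
    also have "\<dots> = 8 * 8 ^ \<Lambda>"
      by (simp flip: power_mult_distrib)
    finally have "real (length (levels \<Lambda>)) \<le> real (8 * 8 ^ \<Lambda>)"
      by (rule of_nat_mono)
    then have "real (length (levels \<Lambda>)) * \<eta> \<le> 8 * 8 ^ \<Lambda> * \<eta>"
      by (intro mult_right_mono) (simp_all add: \<eta>_def)
    also have "\<dots> = 1 / 3 * (8 ^ \<Lambda> / 48 ^ \<Lambda>)"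
      by (simp add: \<eta>_def)
    also have "\<dots> \<le> 1 / 3 * 1"
      by (intro mult_left_mono divide_le_eq_1_pos[THEN iffD2] power_mono) auto
    finally show ?thesis by simp
  qed
  have "1 \<le> 24 * (48::real) ^ \<Lambda>"
    using one_le_power[of "48::real" \<Lambda>] by linarith
  then have \<eta>: "0 \<le> \<eta>" "\<eta> \<le> 1" by (simp_all add: \<eta>_def divide_le_eq)
  let ?a = "\<lambda>l. pmf (run (trial (samples \<Lambda> l) (threshold l) L n) (unif n)) True"
  have "1 - \<eta> \<le> ?a l" for l
    using trial_unif[OF assms samples_pos[of \<Lambda> l] threshold_nonneg[of l]] samples_threshold[of \<Lambda> l]
    unfolding \<eta>_def by linarith
  then have "1 - real (length (map ?a (levels \<Lambda>))) * \<eta> \<le> prod_list (map ?a (levels \<Lambda>))"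
    using \<eta> by (intro conjunct1[OF prod_list_ge_union_bound]) (auto simp: pmf_le_1)
  then show ?thesis
    using len unfolding tester_def pmf_run_conj_strategies by (simp add: o_def)
qed

text \<open>The mean squared bias is at least \<open>\<gamma>\<close>, so at some level l a fraction
  of at least \<gamma> 2^l / (2 (\<Lambda> + 1)) of the pairs is biased. One trial of that level
  rejects with probability at least half this fraction, and the repetitions bring the acceptance
  probability down to exp (-2).\<close>

lemma tester_far:
  fixes \<epsilon> :: real
  assumes "L \<ge> 1" "n \<ge> 1" "n \<le> 2 ^ L" "dist_on n p" "0 \<le> \<epsilon>" "dtv n p (unif n) \<ge> \<epsilon>"
    and "9 * real L \<le> \<epsilon>\<^sup>2 * 2 ^ \<Lambda>"
  shows "pmf (run (tester \<Lambda> L n) p) True \<le> 1 / 3"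
proof -
  let ?X = "{..<L} \<times> {1..n}"
  define Y where "Y = (\<lambda>(j, i). (split_bias p (node 0 n j i))\<^sup>2)"
  define \<gamma> where "\<gamma> = \<epsilon>\<^sup>2 / (9 * real L)"
  have card: "real (card ?X) = real L * real n"
    by (simp add: card_cartesian_product)
  have "(Y x) \<le> 1" for x
  proof -
    obtain j i where x: "x = (j, i)" by fastforce
    obtain a b where ab: "node 0 n j i = (a, b)" by fastforce
    have unit: "0 \<le> u \<Longrightarrow> u \<le> 1 \<Longrightarrow> 0 \<le> v \<Longrightarrow> v \<le> 1 \<Longrightarrow> \<bar>u - v\<bar> \<le> 1" for u v :: real
      by linarith
    have "real ((a + b) div 2 - a) / real (b - a) \<le> 1"
      by (intro divide_le_eq_1[THEN iffD2]) auto
    moreover have "0 \<le> real ((a + b) div 2 - a) / real (b - a)" by simp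
    ultimately have "\<bar>split_bias p (a, b)\<bar> \<le> 1"
      unfolding split_bias_def Let_def case_prod_conv
      by (intro unit measure_pmf.prob_le_1 measure_nonneg)
    then show ?thesis
      by (simp add: Y_def x ab abs_square_le_1)
  qed
  moreover have "\<gamma> * real (card ?X) \<le> sum Y ?X"
  proof -
    have "\<epsilon>\<^sup>2 \<le> (dtv n p (unif n))\<^sup>2"
      using assms(5,6) by (intro power_mono) auto
    then have "real n * \<epsilon>\<^sup>2 \<le> real n * (dtv n p (unif n))\<^sup>2"
      by (intro mult_left_mono) auto
    also have "\<dots> \<le> 9 * sum Y ?X"
      using sum_split_bias_ge[OF assms(2-4)] by (simp add: Y_def sum.cartesian_product)
    finally show ?thesis
      unfolding card \<gamma>_def using assms(1) by (simp add: field_simps)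
  qed
  moreover have "1 \<le> \<gamma> * 2 ^ \<Lambda>"
    using assms(1,7) by (simp add: \<gamma>_def)
  ultimately obtain l where l: "l \<le> \<Lambda>" "\<gamma> * real (card ?X) * 2 ^ l \<le>
      2 * (real \<Lambda> + 1) * real (card {x \<in> ?X. 1 / 2 ^ Suc l \<le> Y x})"
    using exists_dyadic_level[of ?X Y \<gamma> \<Lambda>] by (auto simp: Y_def)
  let ?B = "{(j, i) \<in> ?X. \<bar>split_bias p (node 0 n j i)\<bar> \<ge> 2 * threshold l}"
  have "1 / 2 ^ Suc l \<le> z\<^sup>2 \<longleftrightarrow> 2 * threshold l \<le> \<bar>z\<bar>" for z :: real
  proof -
    have "(1::real) / 2 ^ Suc l = (2 * threshold l)\<^sup>2"
      by (simp add: threshold_def power_mult_distrib power_add)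
    moreover have "\<bar>2 * threshold l\<bar> = 2 * threshold l"
      using threshold_nonneg[of l] by simp
    ultimately show ?thesis
      using abs_le_square_iff[of "2 * threshold l" z] by simp
  qed
  then have B: "{x \<in> ?X. 1 / 2 ^ Suc l \<le> Y x} = ?B"
    by (auto simp: Y_def)
  define c where "c = real (card ?B) / (2 * (real L * real n))"
  let ?a = "\<lambda>l. pmf (run (trial (samples \<Lambda> l) (threshold l) L n) p) True"
  have "2 / 48 ^ Suc \<Lambda> \<le> (2 / 48 :: real)"
    by (simp add: divide_le_eq)
  then have "2 * exp (- 2 * real (samples \<Lambda> l) * (threshold l)\<^sup>2) \<le> 1 / 2"
    using samples_threshold[of \<Lambda> l] by linarith
  then have a: "?a l \<le> 1 - c"
    unfolding c_def by (rule trial_far[OF assms(1,2) samples_pos threshold_nonneg])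
  \<comment> \<open>The factor 8 cancels the 4 lost in \<open>c\<close> (2 from the pigeonhole, 2
    from the trial) and leaves 2.\<close>
  have c: "2 \<le> real (repetitions \<Lambda> l) * c"
  proof -
    have cB: "real (card ?B) = 2 * (c * (real L * real n))"
      using assms(1,2) by (simp add: c_def)
    have "\<gamma> * (real L * real n) * 2 ^ l \<le> 2 * (real \<Lambda> + 1) * (2 * (c * (real L * real n)))"
      using l(2) unfolding B card cB .
    then have "(\<gamma> * 2 ^ l) * (real L * real n) \<le> (4 * (real \<Lambda> + 1) * c) * (real L * real n)"
      by (simp add: algebra_simps)
    then have "\<gamma> * 2 ^ l \<le> 4 * (real \<Lambda> + 1) * c"
      using assms(1,2) by simp
    then have "2 ^ (\<Lambda> - l) * (\<gamma> * 2 ^ l) \<le> 2 ^ (\<Lambda> - l) * (4 * (real \<Lambda> + 1) * c)"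
      by (rule mult_left_mono) simp
    moreover have "2 ^ (\<Lambda> - l) * (\<gamma> * 2 ^ l) = \<gamma> * 2 ^ \<Lambda>"
      using l(1) by (simp add: power_diff)
    moreover have "real (repetitions \<Lambda> l) * c = 2 * (2 ^ (\<Lambda> - l) * (4 * (real \<Lambda> + 1) * c))"
      by (simp add: repetitions_def)
    ultimately show ?thesis
      using \<open>1 \<le> \<gamma> * 2 ^ \<Lambda>\<close> by linarith
  qed
  have "pmf (run (tester \<Lambda> L n) p) True \<le> ?a l ^ repetitions \<Lambda> l"
    unfolding tester_def pmf_run_conj_strategies levels_def map_map o_def
    using l(1) by (intro prod_list_concat_replicate_le) (auto simp: pmf_le_1)
  also have "\<dots> \<le> exp (- c) ^ repetitions \<Lambda> l"
    using a exp_ge_add_one_self[of "- c"] by (intro power_mono) auto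
  also have "\<dots> = exp (- (real (repetitions \<Lambda> l) * c))"
    by (simp flip: exp_of_nat_mult)
  also have "\<dots> \<le> exp (- 2)"
    using c by simp
  also have "\<dots> \<le> 1 / 3"
    using exp_ge_add_one_self[of 2] by (simp add: exp_minus field_simps)
  finally show ?thesis .
qed

section \<open>Choice of parameters and the query bound\<close>

lemma ex_power_two_between:
  fixes y :: real
  assumes "1 \<le> y"
  shows "y \<le> 2 ^ nat \<lceil>log 2 y\<rceil>" "2 ^ nat \<lceil>log 2 y\<rceil> \<le> 2 * y"
proof -
  define k where "k = nat \<lceil>log 2 y\<rceil>"
  have "0 \<le> log 2 y"
    using assms by simp
  then have "log 2 y \<le> real k" "real k \<le> 1 + log 2 y"
    unfolding k_def by linarith+
  then have "2 powr log 2 y \<le> 2 powr real k" "2 powr real k \<le> 2 powr (1 + log 2 y)"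
    by simp_all
  then show "y \<le> 2 ^ nat \<lceil>log 2 y\<rceil>" "2 ^ nat \<lceil>log 2 y\<rceil> \<le> 2 * y"
    unfolding k_def[symmetric] using assms by (simp_all add: powr_realpow powr_add)
qed

definition depth :: "nat \<Rightarrow> nat" where
  "depth n = nat \<lceil>log 2 (real n)\<rceil>"

text \<open>Rounds up the logarithm so that the last hypothesis of \<open>tester_far\<close>
  holds.\<close>

definition precision :: "nat \<Rightarrow> real \<Rightarrow> nat" where
  "precision n \<epsilon> = nat \<lceil>log 2 (9 * real (depth n) / \<epsilon>\<^sup>2)\<rceil>"

text \<open>For n = 1 the depth is 0, so there would be no depth to draw from.\<close>

definition uniformity_tester :: nacond_alg where
  "uniformity_tester n \<epsilon> =
     (if n = 1 then return_pmf ([], \<lambda>_. True) else tester (precision n \<epsilon>) (depth n) n)"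

lemma depth_bounds:
  assumes "n \<ge> 2"
  shows "depth n \<ge> 1" "n \<le> 2 ^ depth n" "real (depth n) \<le> 2 * log 2 (real n)"
proof -
  have "1 \<le> log 2 (real n)"
    using assms by simp
  then show "depth n \<ge> 1" "real (depth n) \<le> 2 * log 2 (real n)"
    unfolding depth_def by linarith+
  have "real n \<le> 2 ^ depth n"
    unfolding depth_def using assms by (intro ex_power_two_between(1)) simp
  then have "real n \<le> real (2 ^ depth n)"
    by simp
  then show "n \<le> 2 ^ depth n"
    by (simp only: of_nat_le_iff)
qed

lemma precision_bounds:
  assumes "n \<ge> 2" "0 < \<epsilon>" "\<epsilon> \<le> 1"
  shows "9 * real (depth n) \<le> \<epsilon>\<^sup>2 * 2 ^ precision n \<epsilon>"
    and "2 ^ precision n \<epsilon> \<le> 36 * (log 2 (real n) / \<epsilon>\<^sup>2)"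
proof -
  have "\<epsilon>\<^sup>2 \<le> 1" "0 < \<epsilon>\<^sup>2"
    using assms by (simp_all add: power_le_one)
  moreover have "1 \<le> real (depth n)"
    using depth_bounds(1)[OF assms(1)] by simp
  ultimately have "1 \<le> 9 * real (depth n) / \<epsilon>\<^sup>2"
    by (simp add: field_simps)
  note b = ex_power_two_between[OF this, folded precision_def]
  show "9 * real (depth n) \<le> \<epsilon>\<^sup>2 * 2 ^ precision n \<epsilon>"
    using b(1) \<open>0 < \<epsilon>\<^sup>2\<close> by (simp add: field_simps)
  note b(2)
  also have "2 * (9 * real (depth n) / \<epsilon>\<^sup>2) \<le> 2 * (9 * (2 * log 2 (real n)) / \<epsilon>\<^sup>2)"
    using depth_bounds(3)[OF assms(1)] by (intro mult_left_mono divide_right_mono) auto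
  finally show "2 ^ precision n \<epsilon> \<le> 36 * (log 2 (real n) / \<epsilon>\<^sup>2)"
    by simp
qed

lemma precision_query_bound:
  assumes "n \<ge> 2" "0 < \<epsilon>" "\<epsilon> \<le> 1"
  shows "real (160 * Suc (precision n \<epsilon>) ^ 3 * 2 ^ precision n \<epsilon>) \<le> query_bound (160 * 7 ^ 3 * 36) 3 n \<epsilon>"
proof -
  define x where "x = log 2 (real n) / \<epsilon>\<^sup>2"
  let ?K = "precision n \<epsilon>"
  have x: "0 \<le> x" using assms by (simp add: x_def)
  have K: "2 ^ ?K \<le> 36 * (1 + x)"
    using precision_bounds(2)[OF assms] by (simp add: x_def)
  \<comment> \<open>A power of two above 36 makes the logarithm exact; then \<Lambda> + 1 <= 7 + 2
    ln (1 + x), which gives the factor 7.\<close>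
  also have "\<dots> \<le> 2 ^ 6 * (1 + x)"
    using x by simp
  finally have "log 2 (2 ^ ?K) \<le> log 2 (2 ^ 6 * (1 + x))"
    using x by (intro log_mono) auto
  moreover have "log 2 (2 ^ 6 * (1 + x)) = 6 + log 2 (1 + x)"
    using x log_pow_cancel[of 2 6] by (subst log_mult) auto
  ultimately have "real ?K \<le> 6 + log 2 (1 + x)"
    by (simp only: log_pow_cancel)
  moreover have "log 2 (1 + x) \<le> 2 * ln (1 + x)"
  proof -
    \<comment> \<open>From exp 1 <= 3 <= 4 follows ln 2 >= 1/2, which converts the binary logarithm
      to the natural one.\<close>
    have "exp (1/2) ^ 2 \<le> (2::real) ^ 2"
      using exp_le by (simp flip: exp_of_nat_mult)
    then have "exp (1/2) \<le> (2::real)"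
      by (rule power2_le_imp_le) simp
    then have "1/2 \<le> ln (2::real)"
      by (subst ln_ge_iff) simp_all
    then have "ln (1 + x) * (1/2) \<le> ln (1 + x) * ln 2"
      using x by (intro mult_left_mono) auto
    then show ?thesis
      by (simp add: log_def field_simps)
  qed
  moreover have ln_nonneg: "0 \<le> ln (1 + x)"
    using x by simp
  ultimately have "real (Suc ?K) \<le> 7 * (1 + ln (1 + x))"
    using ln_nonneg by simp
  then have "real (Suc ?K) ^ 3 \<le> (7 * (1 + ln (1 + x))) ^ 3"
    by (rule power_mono) simp
  then have "160 * real (Suc ?K) ^ 3 * 2 ^ ?K \<le> 160 * (7 * (1 + ln (1 + x))) ^ 3 * (36 * (1 + x))"
    using K x by (intro mult_mono) auto
  also have "160 * (7 * (1 + ln (1 + x))) ^ 3 * (36 * (1 + x)) =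
      160 * 7 ^ 3 * 36 * (1 + x) * (1 + ln (1 + x)) ^ 3"
    by (simp only: power_mult_distrib mult_ac)
  also have "\<dots> = query_bound (160 * 7 ^ 3 * 36) 3 n \<epsilon>"
    by (simp only: query_bound_def Let_def x_def)
  finally show ?thesis
    by simp
qed

theorem theorem2:
  shows "\<exists>(A :: nacond_alg) (C :: real) (k :: nat).
    \<forall>n :: nat. \<forall>\<epsilon> :: real. n \<ge> 1 \<and> 0 < \<epsilon> \<and> \<epsilon> \<le> 1 \<longrightarrow>
      (\<forall>(Qs, D) \<in> set_pmf (A n \<epsilon>).
          (\<forall>S \<in> set Qs. S \<noteq> {} \<and> S \<subseteq> {1..n}) \<and>
          real (length Qs) \<le> query_bound C k n \<epsilon>) \<and>
      (\<forall>p. dist_on n p \<longrightarrow>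
          (p = unif n \<longrightarrow> measure_pmf.prob (nacond_run A n \<epsilon> p) {True} \<ge> 2/3) \<and>
          (dtv n p (unif n) \<ge> \<epsilon> \<longrightarrow>
              measure_pmf.prob (nacond_run A n \<epsilon> p) {False} \<ge> 2/3))"
proof (intro exI allI impI)
  fix n :: nat and \<epsilon> :: real
  assume *: "n \<ge> 1 \<and> 0 < \<epsilon> \<and> \<epsilon> \<le> 1"
  let ?A = uniformity_tester
  have run: "nacond_run ?A n \<epsilon> p = run (?A n \<epsilon>) p" for p
    by (simp add: nacond_run_def run_def)
  show "(\<forall>(Qs, D) \<in> set_pmf (?A n \<epsilon>).
          (\<forall>S \<in> set Qs. S \<noteq> {} \<and> S \<subseteq> {1..n}) \<and>
          real (length Qs) \<le> query_bound (160 * 7 ^ 3 * 36) 3 n \<epsilon>) \<and>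
      (\<forall>p. dist_on n p \<longrightarrow>
          (p = unif n \<longrightarrow> measure_pmf.prob (nacond_run ?A n \<epsilon> p) {True} \<ge> 2/3) \<and>
          (dtv n p (unif n) \<ge> \<epsilon> \<longrightarrow>
              measure_pmf.prob (nacond_run ?A n \<epsilon> p) {False} \<ge> 2/3))"
  proof (cases "n = 1")
    case True
    \<comment> \<open>On a one-point domain the only distribution is uniform, so the far case is
      void and accepting without queries is correct.\<close>
    have "dtv n p (unif n) = 0" if "dist_on n p" for p
    proof -
      have "p = return_pmf 1"
        using that True by (simp add: dist_on_def set_pmf_subset_singleton)
      then show ?thesis
        using True by (simp add: dtv_def unif_def pmf_of_set_singleton)
    qed
    moreover have "nacond_run ?A n \<epsilon> p = return_pmf True" for p
      using True unfolding run by (simp add: uniformity_tester_def run_def bind_return_pmf)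
    ultimately show ?thesis
      using * True
      by (auto simp: uniformity_tester_def query_bound_def measure_pmf_single)
  next
    case False
    with * have n: "n \<ge> 2" by simp
    let ?T = "tester (precision n \<epsilon>) (depth n) n"
    have A: "?A n \<epsilon> = ?T" using False by (simp add: uniformity_tester_def)
    have "pmf (run ?T p) False = 1 - pmf (run ?T p) True" for p
      using sum_pmf_eq_1[OF finite subset_UNIV, of "run ?T p"] by (simp add: UNIV_bool)
    then have "pmf (run ?T p) False \<ge> 2 / 3" if "dist_on n p" "dtv n p (unif n) \<ge> \<epsilon>" for p
      using tester_far[OF depth_bounds(1)[OF n] _ depth_bounds(2)[OF n] that(1) _ that(2)
          precision_bounds(1)[OF n]] * by simp
    moreover have "pmf (run ?T (unif n)) True \<ge> 2 / 3"
      using tester_unif[OF depth_bounds(1)[OF n]] * by simp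
    moreover have "(\<forall>S \<in> set Qs. S \<noteq> {} \<and> S \<subseteq> {1..n}) \<and>
        real (length Qs) \<le> query_bound (160 * 7 ^ 3 * 36) 3 n \<epsilon>" if "(Qs, D) \<in> set_pmf ?T" for Qs D
      using tester_queries[OF depth_bounds(1)[OF n] _ that] precision_query_bound[OF n] * by auto
    ultimately show ?thesis
      unfolding run A measure_pmf_single by blast
  qed
qed

end
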